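(* Let $p$ be a prime and let $\mathcal{I}$ and $\mathcal{J}$ be subsets of $\mathbb{F}_p^*$, each consisting of $\lfloor\sqrt{8p}\rfloor$ consecutive integers modulo $p$. Then every integer $\lambda$ can be represented in the form $$\frac{m_1}{x_1}+\frac{m_2}{x_2}\equiv \lambda \pmod p,\qquad m_1,m_2\in\mathcal{I},\quad x_1,x_2\in\mathcal{J}.$$
   Context: $\mathbb{F}_p$ is the field of residues modulo $p$, identified with $\{0,1,\ldots,p-1\}$, $\mathbb{F}_p^*=\mathbb{F}_p\setminus\{0\}$. A set of $N$ consecutive integers modulo $p$ means a set $\{L+1,L+2,\ldots,L+N\}$ reduced modulo $p$ for some integer $L$. $m/x$ denotes $m x^{-1}$ in $\mathbb{F}_p$. *)

theory Defs
  imports Complex_Main "HOL-Number_Theory.Residues"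
begin

text \<open>The reductions modulo \<open>p\<close> of \<open>L + 1, \<dots>, L + N\<close>, taken in \<open>{0..p - 1}\<close>, which is the carrier
  of \<^term>\<open>residue_ring p\<close>; the block may wrap around modulo \<open>p\<close>.\<close>

definition consecutive_mod :: "int \<Rightarrow> int \<Rightarrow> int set \<Rightarrow> bool" where
  "consecutive_mod p N S \<longleftrightarrow> (\<exists>L. S = (\<lambda>k. k mod p) ` {L + 1..L + N})"

definition res_div :: "int \<Rightarrow> int \<Rightarrow> int \<Rightarrow> int" where
  "res_div p m x = m \<otimes>\<^bsub>residue_ring p\<^esub> inv\<^bsub>residue_ring p\<^esub> x"

end

theory Submission
  imports Defs "HOL-Library.Discrete_Functions"
begin

text \<open>Let \<open>N = \<lfloor>sqrt (8 p)\<rfloor>\<close>. It suffices that the set \<open>S\<close> of all fractions \<open>m / x\<close> contains more than half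
  of the residues, as then \<open>S\<close> meets \<open>lam - S\<close>. A residue \<open>a\<close> lies in \<open>S\<close> if the lattice of the
  \<open>(x, m)\<close> with \<open>m \<equiv> a x\<close> meets the box \<open>J \<times> I\<close>, and it does so if it contains two independent vectors
  whose parallelogram fits into an \<open>N \<times> N\<close> box. Thue's lemma gives a lattice vector of sup norm
  \<open>l \<le> sqrt p\<close>, and a second one of sup norm at most \<open>p / l\<close> completes it to a basis. The
  parallelogram fits if \<open>l + p / l \<le> N\<close>, which fails only if \<open>5 l\<^sup>2 < p\<close>. The vector determines \<open>a\<close>,
  so with \<open>M = \<lfloor>sqrt ((p - 1) / 5)\<rfloor>\<close> at most \<open>M (2 M + 1) < p / 2\<close> residues are missed.\<close>

section \<open>Lattice points in boxes\<close>

text \<open>One coordinate of the claim that a half-open parallelogram fits into a box. The values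
  \<open>z\<close> range over an interval of length \<bar>u1\<bar> + \<bar>u2\<bar>, which could
  hold N + 1 integers; as the coefficients stay below 1, a nonzero end of the interval is not
  attained, and N places suffice.\<close>

lemma interval_absorbs_pair:
  fixes u1 u2 N B :: int
  assumes "u1 \<noteq> 0 \<or> u2 \<noteq> 0" and "\<bar>u1\<bar> + \<bar>u2\<bar> \<le> N"
  shows "\<exists>X. \<forall>\<alpha> \<beta> :: real. \<forall>z :: int. 0 \<le> \<alpha> \<longrightarrow> \<alpha> < 1 \<longrightarrow> 0 \<le> \<beta> \<longrightarrow> \<beta> < 1 \<longrightarrow>
    of_int z = \<alpha> * of_int u1 + \<beta> * of_int u2 \<longrightarrow> B + 1 \<le> X - z \<and> X - z \<le> B + N"
proof -
  \<comment> \<open>The positive parts and the negative parts of \<open>u1\<close> and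
    \<open>u2\<close> give the two ends \<open>P\<close> and \<open>- Q\<close> of the range of
    \<open>z\<close>.\<close>
  define P Q where "P = max u1 0 + max u2 0" and "Q = max (- u1) 0 + max (- u2) 0"
  have PQ: "P + Q \<le> N" "0 \<le> P" "0 \<le> Q" "P > 0 \<or> Q > 0"
    using assms unfolding P_def Q_def by auto
  have bounds: "- Q \<le> z \<and> z \<le> P \<and> (P > 0 \<longrightarrow> z < P) \<and> (Q > 0 \<longrightarrow> - Q < z)"
    if ab: "0 \<le> \<alpha>" "\<alpha> < 1" "0 \<le> \<beta>" "\<beta> < 1" and z: "of_int z = \<alpha> * of_int u1 + \<beta> * of_int u2"
    for \<alpha> \<beta> :: real and z
  proof -
    have up: "c * of_int u \<le> of_int (max u 0)" "u > 0 \<longrightarrow> c * of_int u < of_int (max u 0)"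
      and lo: "- of_int (max (- u) 0) \<le> c * of_int u" "u < 0 \<longrightarrow> - of_int (max (- u) 0) < c * of_int u"
      if "0 \<le> c" "c < 1" for c :: real and u :: int
    proof -
      show "c * of_int u \<le> of_int (max u 0)"
        using that by (cases "u \<ge> 0") (auto simp: mult_left_le_one_le mult_nonneg_nonpos max_def)
      show "u > 0 \<longrightarrow> c * of_int u < of_int (max u 0)"
        using that by (auto simp: max_def)
      show "- of_int (max (- u) 0) \<le> c * of_int u"
      proof (cases "u \<ge> 0")
        case False
        then have "(1 - c) * of_int u \<le> 0" using that by (intro mult_nonneg_nonpos) auto
        then show ?thesis using False by (simp add: algebra_simps max_def)
      qed (use that in \<open>auto simp: max_def\<close>)
      show "u < 0 \<longrightarrow> - of_int (max (- u) 0) < c * of_int u"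
        using that by (auto simp: max_def)
    qed
    have "real_of_int z \<le> of_int P" "- of_int Q \<le> real_of_int z"
      using up(1)[of \<alpha> u1] up(1)[of \<beta> u2] lo(1)[of \<alpha> u1] lo(1)[of \<beta> u2] ab z
      unfolding P_def Q_def by auto
    moreover have "real_of_int z < of_int P" if "P > 0"
    proof -
      from that have "u1 > 0 \<or> u2 > 0" unfolding P_def by auto
      then show ?thesis
        using up[of \<alpha> u1] up[of \<beta> u2] ab z unfolding P_def of_int_add by (elim disjE; linarith)
    qed
    moreover have "- of_int Q < real_of_int z" if "Q > 0"
    proof -
      from that have "u1 < 0 \<or> u2 < 0" unfolding Q_def by auto
      then show ?thesis
        using lo[of \<alpha> u1] lo[of \<beta> u2] ab z unfolding Q_def of_int_add by (elim disjE; linarith)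
    qed
    ultimately show ?thesis by linarith
  qed
  show ?thesis
    \<comment> \<open>If \<open>P > 0\<close>, the end \<open>P\<close> is not attained and
      \<open>z\<close> starts at \<open>- Q\<close> at the earliest; if \<open>P = 0\<close>, then
      \<open>Q > 0\<close> and the end \<open>- Q\<close> is not attained, which shifts
      \<open>X\<close> by one.\<close>
    by (rule exI[of _ "if P > 0 then B + N - Q else B + N - Q + 1"])
       (use bounds PQ in \<open>smt (verit)\<close>)
qed

text \<open>The translates of the half-open parallelogram spanned by \<open>(u1, w1)\<close> and
  \<open>(u2, w2)\<close> tile the plane. The point \<open>(X, Y)\<close> is placed so that
  subtracting any integer point of the parallelogram lands in the box; the tile containing
  \<open>(X, Y)\<close> then has its corner in the box.\<close>

lemma parallelogram_tiling:
  fixes u1 u2 w1 w2 N A B :: int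
  assumes D: "u1 * w2 - u2 * w1 \<noteq> 0"
    and "\<bar>u1\<bar> + \<bar>u2\<bar> \<le> N" and "\<bar>w1\<bar> + \<bar>w2\<bar> \<le> N"
  shows "\<exists>i j. i * u1 + j * u2 \<in> {B + 1..B + N} \<and> i * w1 + j * w2 \<in> {A + 1..A + N}"
proof -
  have "u1 \<noteq> 0 \<or> u2 \<noteq> 0" "w1 \<noteq> 0 \<or> w2 \<noteq> 0" using D by auto
  with assms obtain X Y where
    X: "\<And>(\<alpha>::real) \<beta> z. 0 \<le> \<alpha> \<Longrightarrow> \<alpha> < 1 \<Longrightarrow> 0 \<le> \<beta> \<Longrightarrow> \<beta> < 1 \<Longrightarrow>
       of_int z = \<alpha> * of_int u1 + \<beta> * of_int u2 \<Longrightarrow> B + 1 \<le> X - z \<and> X - z \<le> B + N" and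
    Y: "\<And>(\<alpha>::real) \<beta> z. 0 \<le> \<alpha> \<Longrightarrow> \<alpha> < 1 \<Longrightarrow> 0 \<le> \<beta> \<Longrightarrow> \<beta> < 1 \<Longrightarrow>
       of_int z = \<alpha> * of_int w1 + \<beta> * of_int w2 \<Longrightarrow> A + 1 \<le> Y - z \<and> Y - z \<le> A + N"
    by (metis interval_absorbs_pair)
  \<comment> \<open>Cramer's rule: the coordinates of \<open>(X, Y)\<close> with respect to the two
    vectors.\<close>
  define d \<alpha> \<beta> where "d = real_of_int (u1 * w2 - u2 * w1)"
    and "\<alpha> = of_int (X * w2 - Y * u2) / d" and "\<beta> = of_int (Y * u1 - X * w1) / d"
  have d0: "d \<noteq> 0" using D unfolding d_def by linarith
  have d: "d = of_int u1 * of_int w2 - of_int u2 * of_int w1" by (simp add: d_def)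
  have "(\<alpha> * of_int u1 + \<beta> * of_int u2) * d = of_int X * d"
    unfolding \<alpha>_def \<beta>_def using d0 by (simp add: distrib_right) (simp add: d algebra_simps)
  then have X': "\<alpha> * of_int u1 + \<beta> * of_int u2 = of_int X" using d0 by simp
  have "(\<alpha> * of_int w1 + \<beta> * of_int w2) * d = of_int Y * d"
    unfolding \<alpha>_def \<beta>_def using d0 by (simp add: distrib_right) (simp add: d algebra_simps)
  then have Y': "\<alpha> * of_int w1 + \<beta> * of_int w2 = of_int Y" using d0 by simp
  have fr: "0 \<le> frac \<alpha>" "frac \<alpha> < 1" "0 \<le> frac \<beta>" "frac \<beta> < 1"
    by (auto simp: frac_lt_1)
  let ?i = "\<lfloor>\<alpha>\<rfloor>" and ?j = "\<lfloor>\<beta>\<rfloor>"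
  have "of_int (X - (?i * u1 + ?j * u2)) = frac \<alpha> * of_int u1 + frac \<beta> * of_int u2"
    unfolding frac_def using X' by (simp add: algebra_simps)
  from X[OF fr this] have 1: "?i * u1 + ?j * u2 \<in> {B + 1..B + N}" by simp
  have "of_int (Y - (?i * w1 + ?j * w2)) = frac \<alpha> * of_int w1 + frac \<beta> * of_int w2"
    unfolding frac_def using Y' by (simp add: algebra_simps)
  from Y[OF fr this] have 2: "?i * w1 + ?j * w2 \<in> {A + 1..A + N}" by simp
  from 1 2 show ?thesis by blast
qed

section \<open>Short lattice vectors\<close>

text \<open>The equation fixes \<open>x\<close> modulo \<open>r\<close>, which leaves a choice of
  sign. With \<open>s * x \<le> 0\<close>, the value r * y = p + s * x is at most \<open>p\<close>,
  and it is nonnegative because \<bar>s * x\<bar> \<le> r * r \<le> p.\<close>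

lemma complementary_vector:
  fixes r s p :: int
  assumes "coprime r s" "\<bar>s\<bar> \<le> r" "1 \<le> r" "r\<^sup>2 \<le> p"
  shows "\<exists>x y. r * y - s * x = p \<and> \<bar>x\<bar> < r \<and> r * \<bar>y\<bar> \<le> p"
proof -
  obtain b where "[s * b = 1] (mod r)"
    using assms(1) cong_solve_coprime_int[of s r] by (auto simp: coprime_commute)
  then have sb: "[s * (b * (- p)) = - p] (mod r)"
    using cong_scalar_right[of "s * b" 1 r "- p"] by (simp add: mult.assoc)
  define x0 where "x0 = (b * (- p)) mod r"
  have x0: "0 \<le> x0" "x0 < r" using assms(3) by (auto simp: x0_def)
  have x0s: "[s * x0 = - p] (mod r)"
    using sb unfolding x0_def cong_def by (simp add: mod_mult_right_eq)
  \<comment> \<open>The shift is made only for \<open>x0 > 0\<close>, since for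
    \<open>x0 = 0\<close> it would give absolute value \<open>r\<close> instead of less than
    \<open>r\<close>.\<close>
  define x where "x = (if s > 0 \<and> x0 > 0 then x0 - r else x0)"
  have xr: "\<bar>x\<bar> < r" using x0 by (auto simp: x_def)
  have sx: "s * x \<le> 0"
  proof (cases "s > 0")
    case True
    then show ?thesis using x0 by (auto simp: x_def mult_nonneg_nonpos)
  next
    case False
    then show ?thesis using x0 by (simp add: x_def mult_nonpos_nonneg)
  qed
  have "[s * x = - p] (mod r)"
    using x0s by (auto simp: x_def cong_def right_diff_distrib mod_diff_right_eq[symmetric])
  then have "r dvd p + s * x" by (simp add: cong_iff_dvd_diff add.commute)
  then obtain y where y: "p + s * x = r * y" by (elim dvdE)
  have "\<bar>s * x\<bar> \<le> r * r" unfolding abs_mult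
    using assms(2) xr by (intro mult_mono) auto
  then have "0 \<le> r * y" using assms(4) y by (auto simp: power2_eq_square)
  then have "0 \<le> y" using assms(3) by (simp add: zero_le_mult_iff)
  then have "r * \<bar>y\<bar> \<le> p" using y sx by auto
  then show ?thesis using y xr by (intro exI[of _ x] exI[of _ y]) auto
qed

lemma abs_less_of_power2_le:
  fixes z q :: int
  assumes "z\<^sup>2 \<le> q" "2 \<le> q"
  shows "\<bar>z\<bar> < q"
proof (rule ccontr)
  assume "\<not> ?thesis"
  then have "q * q \<le> \<bar>z\<bar> * \<bar>z\<bar>" using assms(2) by (intro mult_mono) auto
  moreover have "2 * q \<le> q * q" using assms(2) by (intro mult_right_mono) auto
  moreover have "\<bar>z\<bar> * \<bar>z\<bar> = z\<^sup>2" by (simp add: power2_eq_square)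
  ultimately show False using assms by linarith
qed

lemma coprime_prime_of_power2_le:
  fixes p :: nat and r :: int
  assumes "prime p" "1 \<le> r" "r\<^sup>2 \<le> int p"
  shows "coprime r (int p)"
proof -
  have "r < int p" using abs_less_of_power2_le[OF assms(3)] prime_ge_2_nat[OF assms(1)] by simp
  then have "\<not> int p dvd r" using assms(2) by (intro zdvd_not_zless) auto
  then show ?thesis using assms(1) prime_imp_coprime[of "int p" r] by (auto simp: coprime_commute)
qed

text \<open>Pigeonhole on more than \<open>p\<close> pairs, where the difference of two colliding
  pairs is the vector. Coprimality, which allows completion to a basis, comes from dividing by the
  gcd; this keeps the congruence because the gcd is prime to \<open>p\<close>.\<close>

lemma thue:
  fixes p :: nat and a :: int
  assumes "prime p"
  shows "\<exists>r s. coprime r s \<and> 1 \<le> r \<and> r\<^sup>2 \<le> int p \<and> s\<^sup>2 \<le> int p \<and> [s = a * r] (mod int p)"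
proof -
  have p2: "2 \<le> p" using assms by (simp add: prime_ge_2_nat)
  define k where "k = floor_sqrt p"
  have k: "k ^ 2 \<le> p" "p < (Suc k)\<^sup>2" unfolding k_def
    using Suc_floor_sqrt_power2_gt by auto
  have sq: "z\<^sup>2 \<le> int p" if "\<bar>z\<bar> \<le> int k" for z
  proof -
    have "z\<^sup>2 \<le> (int k)\<^sup>2" using that by (metis abs_ge_zero power2_abs power_mono)
    then show ?thesis using k(1) by (metis of_nat_le_iff of_nat_power order_trans)
  qed
  define f where "f = (\<lambda>(x, y). (a * x - y) mod int p)"
  let ?A = "{0..int k} \<times> {0..int k}"
  have "f ` ?A \<subseteq> {0..<int p}" using p2 by (auto simp: f_def)
  then have "card (f ` ?A) \<le> p" using card_mono[of "{0..<int p}"] by force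
  moreover have "card ?A = (Suc k)\<^sup>2" by (simp add: card_cartesian_product power2_eq_square nat_add_distrib)
  ultimately have "\<not> inj_on f ?A" using k(2) card_image[of f ?A] by linarith
  then obtain x y x' y' where xy: "x \<in> {0..int k}" "y \<in> {0..int k}" "x' \<in> {0..int k}" "y' \<in> {0..int k}"
    "(x, y) \<noteq> (x', y')" "(a * x - y) mod int p = (a * x' - y') mod int p"
    unfolding inj_on_def f_def by fastforce
  have dv: "int p dvd a * (x - x') - (y - y')"
    using xy(6) unfolding mod_eq_dvd_iff by (simp add: algebra_simps)
  have xs: "(x - x')\<^sup>2 \<le> int p" "(y - y')\<^sup>2 \<le> int p" using xy by (intro sq; simp; linarith)+
  \<comment> \<open>Equal first coordinates would make \<open>p\<close> divide y - y', which is
    smaller than \<open>p\<close> in absolute value, so the pairs would coincide.\<close>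
  have x0: "x \<noteq> x'"
  proof
    assume "x = x'"
    then have "int p dvd \<bar>y - y'\<bar>" using dv by (simp add: dvd_diff_commute)
    then have "y = y'"
      using abs_less_of_power2_le[OF xs(2)] p2 zdvd_not_zless[of "\<bar>y - y'\<bar>" "int p"] by linarith
    with \<open>x = x'\<close> xy(5) show False by simp
  qed
  define e where "e = sgn (x - x')"
  define r0 s0 where "r0 = e * (x - x')" and "s0 = e * (y - y')"
  have e: "e = 1 \<or> e = -1" using x0 by (auto simp: e_def sgn_if)
  have r0: "1 \<le> r0" "r0\<^sup>2 \<le> int p" "s0\<^sup>2 \<le> int p" 
    using e xs x0 unfolding r0_def s0_def by (auto simp: e_def sgn_if power2_commute)
  have dv0: "int p dvd a * r0 - s0"
    using dvd_mult[OF dv, of e] unfolding r0_def s0_def by (simp add: algebra_simps)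
  define g where "g = gcd r0 s0"
  have g: "1 \<le> g" using r0(1) gcd_pos_int[of r0 s0] unfolding g_def by linarith
  obtain r s where rs: "r0 = r * g" "s0 = s * g" "coprime r s"
    using gcd_coprime_exists[of r0 s0] g unfolding g_def by force
  have r1: "1 \<le> r" using r0(1) rs(1) g by (smt (verit) zero_less_mult_iff)
  have le: "z\<^sup>2 \<le> (z * g)\<^sup>2" for z
    using g by (simp add: power_mult_distrib mult_le_cancel_left1)
  have "g \<le> r0" using r0(1) by (simp add: g_def gcd_le1_int)
  then have "g\<^sup>2 \<le> r0\<^sup>2" using g by (intro power_mono) auto
  then have "coprime (int p) g"
    using coprime_prime_of_power2_le[OF assms g] r0(2) by (auto simp: coprime_commute)
  moreover have "int p dvd (a * r - s) * g" using dv0 rs by (simp add: algebra_simps)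
  ultimately have "int p dvd a * r - s" by (simp add: coprime_dvd_mult_left_iff)
  then have "[s = a * r] (mod int p)" by (simp add: cong_iff_dvd_diff dvd_diff_commute)
  with rs(3) r1 le[of r] le[of s] r0 rs show ?thesis by (meson order_trans)
qed

section \<open>Residues that are fractions from the box\<close>

text \<open>The bound l + p / l < sqrt (8 p) amounts to p^2 - 6 p l^2 + l^4 < 0, which holds for p /
  l^2 between 1 and 5. The exact upper limit is 3 + 2 sqrt 2; the integer 5 below it gives a simple
  factorization.\<close>

lemma short_vectors_fit:
  fixes l x y p N :: int
  assumes l: "1 \<le> l" "l\<^sup>2 \<le> p" "p \<le> 5 * l\<^sup>2" and N: "0 \<le> N" "8 * p < (N + 1)\<^sup>2"
    and xy: "\<bar>x\<bar> < l" "l * \<bar>y\<bar> \<le> p"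
  shows "l + \<bar>x\<bar> \<le> N" and "l + \<bar>y\<bar> \<le> N"
proof -
  have "0 \<le> p" using l(2) zero_le_power2[of l] by linarith
  then have "(2 * l)\<^sup>2 < (N + 1)\<^sup>2" using l(2) N(2) by (simp add: power_mult_distrib)
  then have "2 * l < N + 1" using N(1) by (intro power_less_imp_less_base[of "2 * l" 2]) auto
  then show "l + \<bar>x\<bar> \<le> N" using xy(1) by linarith
  show "l + \<bar>y\<bar> \<le> N"
  proof (rule ccontr)
    assume "\<not> ?thesis"
    then have "l * (N + 1) \<le> l * (l + \<bar>y\<bar>)" using l(1) by (intro mult_left_mono) auto
    then have "l * (N + 1) \<le> l\<^sup>2 + p" using xy(2) by (simp add: distrib_left power2_eq_square)
    then have "(l * (N + 1))\<^sup>2 \<le> (l\<^sup>2 + p)\<^sup>2" using l(1) N(1) by (intro power_mono) auto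
    moreover have "l\<^sup>2 * (8 * p) < l\<^sup>2 * (N + 1)\<^sup>2" using N(2) l(1) by simp
    ultimately have "l\<^sup>2 * (8 * p) < (l\<^sup>2 + p)\<^sup>2" by (simp add: power_mult_distrib)
    moreover have "(p - 5 * l\<^sup>2) * (p - l\<^sup>2) \<le> 0" using l by (intro mult_nonpos_nonneg) auto
    moreover have "(l\<^sup>2 + p)\<^sup>2 - l\<^sup>2 * (8 * p) = (p - 5 * l\<^sup>2) * (p - l\<^sup>2) - 4 * (l\<^sup>2 * l\<^sup>2)"
      by (simp add: power2_eq_square algebra_simps)
    moreover have "0 \<le> l\<^sup>2 * l\<^sup>2" by simp
    ultimately show False by linarith
  qed
qed

lemma fraction_or_short_vector:
  fixes p :: nat and a N A B :: int
  assumes p: "prime p" and N: "0 \<le> N" "8 * int p < (N + 1)\<^sup>2"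
  shows "(\<exists>x\<in>{B + 1..B + N}. \<exists>m\<in>{A + 1..A + N}. [m = a * x] (mod int p)) \<or>
    (\<exists>r s. 1 \<le> r \<and> 5 * r\<^sup>2 < int p \<and> 5 * s\<^sup>2 < int p \<and> [s = a * r] (mod int p))"
proof -
  obtain r s where rs: "coprime r s" "1 \<le> r" "r\<^sup>2 \<le> int p" "s\<^sup>2 \<le> int p" "[s = a * r] (mod int p)"
    using thue[OF p, of a] by blast
  have p2: "2 \<le> int p" using prime_ge_2_nat[OF p] by simp
  have cop: "coprime r (int p)" using rs(2,3) by (rule coprime_prime_of_power2_le[OF p])
  \<comment> \<open>A vector whose determinant with \<open>(r, s)\<close> is a multiple of
    \<open>p\<close> lies in the lattice, because \<open>r\<close> can be cancelled modulo
    \<open>p\<close>.\<close>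
  have mem: "[w = a * u] (mod int p)" if "r * w - s * u = e * int p" for u w e
  proof -
    have "[r * w = s * u] (mod int p)" using that by (simp add: cong_iff_dvd_diff)
    also have "[s * u = r * (a * u)] (mod int p)"
      using cong_scalar_right[OF rs(5), of u] by (simp add: mult_ac)
    finally show ?thesis using cop by (simp add: cong_mult_lcancel)
  qed
  have box: "\<exists>x\<in>{B + 1..B + N}. \<exists>m\<in>{A + 1..A + N}. [m = a * x] (mod int p)"
    if v: "r * w - s * u = e * int p" "e \<noteq> 0" "r + \<bar>u\<bar> \<le> N" "\<bar>s\<bar> + \<bar>w\<bar> \<le> N" for u w e
  proof -
    have "r * w - u * s \<noteq> 0" using v(1,2) p2 by (simp add: mult.commute)
    then obtain i j where ij: "i * r + j * u \<in> {B + 1..B + N}" "i * s + j * w \<in> {A + 1..A + N}"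
      using parallelogram_tiling[of r w u s N B A] v rs(2) by auto
    have "[i * s + j * w = i * (a * r) + j * (a * u)] (mod int p)"
      by (intro cong_add cong_mult cong_refl rs(5) mem[OF v(1)])
    then have "[i * s + j * w = a * (i * r + j * u)] (mod int p)" by (simp add: algebra_simps)
    with ij show ?thesis by blast
  qed
  define l where "l = max r \<bar>s\<bar>"
  have l1: "1 \<le> l" "r \<le> l" "\<bar>s\<bar> \<le> l" using rs(2) by (auto simp: l_def)
  have l2: "l\<^sup>2 \<le> int p" using rs(3,4) by (auto simp: l_def max_def)
  show ?thesis
  \<comment> \<open>If the sup norm \<open>l\<close> is this small, \<open>(r, s)\<close> itself is
    the short vector of the second alternative; otherwise the parallelogram fits.\<close>
  proof (cases "5 * l\<^sup>2 < int p")
    case True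
    moreover have "r\<^sup>2 \<le> l\<^sup>2" using l1 rs(2) by (intro power_mono) auto
    moreover have "s\<^sup>2 \<le> l\<^sup>2" using l1 by (metis abs_ge_zero power2_abs power_mono)
    ultimately show ?thesis using rs(2,5) by (intro disjI2 exI[of _ r] exI[of _ s]) auto
  next
    case False
    then have fit: "l + \<bar>x\<bar> \<le> N" "l + \<bar>y\<bar> \<le> N" if "\<bar>x\<bar> < l" "l * \<bar>y\<bar> \<le> int p" for x y
      using short_vectors_fit[of l "int p" N x y] l1 l2 N that by auto
    show ?thesis
    proof (cases "\<bar>s\<bar> \<le> r")
      case True
      then have "l = r" by (simp add: l_def)
      obtain x y where "r * y - s * x = int p" "\<bar>x\<bar> < r" "r * \<bar>y\<bar> \<le> int p"
        using complementary_vector[OF rs(1) True rs(2,3)] by blast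
      then show ?thesis using box[of y x 1] fit[of x y] l1 \<open>l = r\<close> by auto
    next
      case False
      then have "l = \<bar>s\<bar>" by (simp add: l_def)
      \<comment> \<open>Here the second coordinate dominates, so the coordinates are swapped and the
        sign is adjusted to make the leading one positive. The determinant becomes \<open>p\<close>
        up to sign, hence the factor \<open>e\<close> in \<open>box\<close>.\<close>
      have e: "sgn s * s = \<bar>s\<bar>" "sgn s = 1 \<or> sgn s = -1" using False rs(2) by (auto simp: sgn_if)
      have "coprime \<bar>s\<bar> (sgn s * r)" "\<bar>sgn s * r\<bar> \<le> \<bar>s\<bar>"
        using e(2) rs(1,2) False by (auto simp: coprime_commute)
      then obtain x y where xy: "\<bar>s\<bar> * y - sgn s * r * x = int p" "\<bar>x\<bar> < \<bar>s\<bar>" "\<bar>s\<bar> * \<bar>y\<bar> \<le> int p"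
        using complementary_vector[of "\<bar>s\<bar>" "sgn s * r" "int p"] l1(1) l2 \<open>l = \<bar>s\<bar>\<close> by auto
      have "r * x - s * y = (- sgn s) * int p"
        using xy(1) e(2) unfolding e(1)[symmetric] by auto
      then show ?thesis using box[of x y "- sgn s"] fit[of x y] xy e(2) l1 \<open>l = \<bar>s\<bar>\<close> by auto
    qed
  qed
qed

section \<open>Counting the exceptional residues\<close>

text \<open>Since \<open>r\<close> is invertible modulo \<open>p\<close>, the pair
  \<open>(r, s)\<close> determines \<open>a\<close>, so counting the pairs suffices.\<close>

lemma card_short_vector_slopes:
  fixes p :: nat
  assumes p: "prime p"
  shows "2 * card {a \<in> {0..<int p}. \<exists>r s. 1 \<le> r \<and> 5 * r\<^sup>2 < int p \<and> 5 * s\<^sup>2 < int p \<and>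
    [s = a * r] (mod int p)} < p" (is "2 * card ?Bad < p")
proof -
  have p2: "2 \<le> p" using prime_ge_2_nat[OF p] by simp
  \<comment> \<open>Subtracting 1 before the division encodes the strict inequality:
    \<open>M\<close> is the largest natural number with 5 M^2 < p.\<close>
  define M where "M = floor_sqrt ((p - 1) div 5)"
  have "M\<^sup>2 \<le> (p - 1) div 5" unfolding M_def by simp
  then have M: "5 * M\<^sup>2 < p" using p2 by linarith
  have le: "\<bar>z\<bar> \<le> int M" if "5 * z\<^sup>2 < int p" for z
  proof -
    have "int (5 * (nat \<bar>z\<bar>)\<^sup>2) < int p" using that by simp
    then have "(nat \<bar>z\<bar>)\<^sup>2 \<le> (p - 1) div 5" by linarith
    then have "nat \<bar>z\<bar> \<le> M" unfolding M_def by (simp add: le_floor_sqrtI)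
    then show ?thesis by linarith
  qed
  let ?K = "{1..int M} \<times> {- int M..int M}"
  have "\<forall>a\<in>?Bad. \<exists>q\<in>?K. [snd q = a * fst q] (mod int p) \<and> 5 * (fst q)\<^sup>2 < int p"
  proof
    fix a assume "a \<in> ?Bad"
    then obtain r s where rs: "1 \<le> r" "5 * r\<^sup>2 < int p" "5 * s\<^sup>2 < int p" "[s = a * r] (mod int p)"
      by blast
    then have "(r, s) \<in> ?K" using le[of r] le[of s] by auto
    with rs show "\<exists>q\<in>?K. [snd q = a * fst q] (mod int p) \<and> 5 * (fst q)\<^sup>2 < int p"
      by (intro bexI[of _ "(r, s)"]) auto
  qed
  then obtain h where h: "\<And>a. a \<in> ?Bad \<Longrightarrow> h a \<in> ?K"
    "\<And>a. a \<in> ?Bad \<Longrightarrow> [snd (h a) = a * fst (h a)] (mod int p) \<and> 5 * (fst (h a))\<^sup>2 < int p"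
    using bchoice[of ?Bad "\<lambda>a q. q \<in> ?K \<and> [snd q = a * fst q] (mod int p) \<and> 5 * (fst q)\<^sup>2 < int p"]
    by blast
  have "inj_on h ?Bad"
  proof (rule inj_onI)
    fix a b assume ab: "a \<in> ?Bad" "b \<in> ?Bad" "h a = h b"
    define r where "r = fst (h a)"
    have r: "1 \<le> r" "5 * r\<^sup>2 < int p" using h[OF ab(1)] by (auto simp: r_def)
    then have "r\<^sup>2 \<le> int p" using zero_le_power2[of r] by linarith
    then have cop: "coprime r (int p)" by (rule coprime_prime_of_power2_le[OF p r(1)])
    have "[a * r = b * r] (mod int p)"
      using h(2)[OF ab(1)] h(2)[OF ab(2)] ab(3) unfolding r_def by (metis cong_sym cong_trans)
    then have "[a = b] (mod int p)" using cop by (simp add: cong_mult_rcancel)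
    then show "a = b" using ab(1,2) by (simp add: cong_def)
  qed
  then have "card ?Bad \<le> card ?K" using h(1) by (intro card_inj_on_le[of h]) blast+
  also have "card ?K = M * (2 * M + 1)" by (simp add: card_cartesian_product nat_add_distrib nat_mult_distrib)
  finally have "2 * card ?Bad \<le> 4 * M\<^sup>2 + 2 * M" by (simp add: power2_eq_square algebra_simps)
  also have "\<dots> < p"
  proof -
    \<comment> \<open>For \<open>M \<ge> 2\<close>, 2 M \<le> M^2 reduces the bound to 5 M^2 < p.
      For \<open>M = 1\<close> the bound is 6, while 5 < p leaves \<open>p = 6\<close> to be
      excluded by primality.\<close>
    consider "M = 0" | "M = 1" | "M \<ge> 2" by linarith
    then show ?thesis
    proof cases
      case 2
      moreover have "\<not> prime (6 :: nat)" using prime_nat_not_dvd[of 6 2] by auto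
      ultimately show ?thesis using M p by (cases "p = 6") auto
    next
      case 3
      then have "2 * M \<le> M * M" by (intro mult_right_mono) auto
      with M show ?thesis unfolding power2_eq_square by linarith
    qed (use p2 in simp)
  qed
  finally show ?thesis .
qed

section \<open>Division in the field and sums of two fractions\<close>

lemma (in residues_prime) res_div_eqI:
  assumes "x \<in> carrier R - {\<zero>}" "a \<in> carrier R" "m \<in> carrier R" "[m = a * x] (mod int p)"
  shows "res_div (int p) m x = a"
proof -
  have "m = a \<otimes> x" using assms by (simp add: res_mult_eq cong_def res_carrier_eq)
  moreover have "x \<in> Units R" using assms(1) field_Units by simp
  ultimately show ?thesis
    using assms unfolding res_div_def R_def[symmetric] by (simp add: m_assoc Units_r_inv)
qed

text \<open>\<open>S\<close> and its reflection lam - S have the same size, and together they would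
  exceed the \<open>p\<close> residues if they were disjoint.\<close>

lemma sum_of_two_from_majority:
  fixes p :: nat and S :: "int set" and lam :: int
  assumes S: "S \<subseteq> {0..<int p}" and card: "p < 2 * card S"
  shows "\<exists>a\<in>S. \<exists>b\<in>S. [a + b = lam] (mod int p)"
proof (rule ccontr)
  assume no: "\<not> ?thesis"
  have p0: "0 < int p" using S card by (cases "p = 0") auto
  let ?f = "\<lambda>a. (lam - a) mod int p"
  have fin: "finite S" using S finite_subset by blast
  have "inj_on ?f S"
  proof (rule inj_onI)
    fix a b assume ab: "a \<in> S" "b \<in> S" "?f a = ?f b"
    then have "int p dvd a - b" by (simp add: mod_eq_dvd_iff dvd_diff_commute)
    then have "a mod int p = b mod int p" by (simp add: mod_eq_dvd_iff)
    with ab S show "a = b" by (auto simp: subset_iff)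
  qed
  then have "card (?f ` S) = card S" by (rule card_image)
  moreover have "S \<inter> ?f ` S = {}"
  proof -
    have "[a + (lam - a) mod int p = lam] (mod int p)" for a
      by (simp add: cong_def mod_add_right_eq)
    then show ?thesis using no by fastforce
  qed
  ultimately have "card (S \<union> ?f ` S) = 2 * card S" using fin by (simp add: card_Un_disjoint)
  moreover have "S \<union> ?f ` S \<subseteq> {0..<int p}" using S p0 by auto
  then have "card (S \<union> ?f ` S) \<le> p" using card_mono[of "{0..<int p}"] by fastforce
  ultimately show False using card by simp
qed

theorem theorem1p3:
  fixes p :: nat and I J :: "int set" and lam :: int
  assumes "prime p"
    and "I \<subseteq> carrier (residue_ring p) - {\<zero>\<^bsub>residue_ring p\<^esub>}"
    and "J \<subseteq> carrier (residue_ring p) - {\<zero>\<^bsub>residue_ring p\<^esub>}"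
    and "consecutive_mod p \<lfloor>sqrt (8 * real p)\<rfloor> I"
    and "consecutive_mod p \<lfloor>sqrt (8 * real p)\<rfloor> J"
  shows "\<exists>m1\<in>I. \<exists>m2\<in>I. \<exists>x1\<in>J. \<exists>x2\<in>J.
    [res_div p m1 x1 \<oplus>\<^bsub>residue_ring p\<^esub> res_div p m2 x2 = lam] (mod int p)"
proof -
  interpret residues_prime p "residue_ring (int p)"
    using assms(1) by (simp add: residues_prime_def)
  define N where "N = \<lfloor>sqrt (8 * real p)\<rfloor>"
  have N0: "0 \<le> N" by (simp add: N_def)
  \<comment> \<open>The floor is turned into an inequality between integers, the form in which the
    lattice lemmas take it.\<close>
  have "sqrt (8 * real p) < of_int (N + 1)" unfolding N_def by linarith
  then have "(sqrt (8 * real p))\<^sup>2 < (of_int (N + 1))\<^sup>2" by (intro power_strict_mono) auto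
  then have "real_of_int (8 * int p) < of_int ((N + 1)\<^sup>2)" by simp
  then have N1: "8 * int p < (N + 1)\<^sup>2" by (simp only: of_int_less_iff)
  obtain A B where A: "I = (\<lambda>k. k mod int p) ` {A + 1..A + N}"
    and B: "J = (\<lambda>k. k mod int p) ` {B + 1..B + N}"
    using assms(4,5) unfolding consecutive_mod_def N_def by blast
  define S where "S = {a \<in> {0..<int p}. \<exists>m\<in>I. \<exists>x\<in>J. res_div p m x = a}"
  let ?Bad = "{a \<in> {0..<int p}. \<exists>r s. 1 \<le> r \<and> 5 * r\<^sup>2 < int p \<and> 5 * s\<^sup>2 < int p \<and>
    [s = a * r] (mod int p)}"
  have "{0..<int p} \<subseteq> S \<union> ?Bad"
  proof
    fix a assume a: "a \<in> {0..<int p}"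
    show "a \<in> S \<union> ?Bad"
    proof (cases "a \<in> ?Bad")
      case False
      then obtain x m where xm: "x \<in> {B + 1..B + N}" "m \<in> {A + 1..A + N}" "[m = a * x] (mod int p)"
        using fraction_or_short_vector[OF assms(1) N0 N1, of B A a] a by blast
      \<comment> \<open>The lattice argument works with the unreduced blocks of integers, so
        wrapping around modulo \<open>p\<close> causes no trouble; reduction happens only
        here.\<close>
      then have "m mod int p \<in> I" "x mod int p \<in> J" unfolding A B by blast+
      moreover have "[m mod int p = a * (x mod int p)] (mod int p)"
        using xm(3) by (simp add: cong_def mod_mult_right_eq)
      moreover have "a \<in> carrier (residue_ring (int p))" using a by (simp add: res_carrier_eq)
      ultimately have "res_div p (m mod int p) (x mod int p) = a"
        using assms(2,3) by (intro res_div_eqI) auto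
      then show ?thesis using a \<open>m mod int p \<in> I\<close> \<open>x mod int p \<in> J\<close> by (auto simp: S_def)
    qed simp
  qed
  then have "card {0..<int p} \<le> card (S \<union> ?Bad)"
    by (rule card_mono[rotated]) (rule finite_subset[of _ "{0..<int p}"], auto simp: S_def)
  \<comment> \<open>Fewer than half of the residues are exceptional, so \<open>S\<close> has more
    than half of them.\<close>
  then have "p \<le> card S + card ?Bad" using card_Un_le[of S ?Bad] by simp
  then have "p < 2 * card S" using card_short_vector_slopes[OF assms(1)] by linarith
  moreover have "S \<subseteq> {0..<int p}" by (auto simp: S_def)
  ultimately obtain a b where ab: "a \<in> S" "b \<in> S" "[a + b = lam] (mod int p)"
    using sum_of_two_from_majority by blast
  then obtain m1 x1 m2 x2 where "m1 \<in> I" "x1 \<in> J" "m2 \<in> I" "x2 \<in> J"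
    "res_div p m1 x1 = a" "res_div p m2 x2 = b"
    unfolding S_def by blast
  moreover have "[a \<oplus>\<^bsub>residue_ring p\<^esub> b = lam] (mod int p)"
    using ab(3) by (simp add: res_add_eq cong_def)
  ultimately show ?thesis by blast
qed

end
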